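(* For every non-negative integer $m$, $$\sum_{n=0}^{m}\frac{1}{16^n}\binom{2n}{n}^{2}=\frac{(2m+1)^2}{16^m}\binom{2m}{m}^{2}\sum_{j=0}^{m}(-1)^j\binom{m}{j}\frac{16^j}{(2j+1)^2\binom{2j}{j}^{2}},$$ $$\sum_{n=0}^{m}\frac{1}{16^n}\binom{2n}{n}^{2}H_n=\frac{(2m+1)^2}{16^m}\binom{2m}{m}^{2}\sum_{j=0}^{m}(-1)^j\binom{m}{j}\frac{16^j(H_m+H_j)}{(2j+1)^2\binom{2j}{j}^{2}}.$$
   Context: $H_n=\sum_{k=1}^n\frac1k$ is the $n$-th harmonic number, $H_0=0$. *)

theory Defs
  imports "HOL-Analysis.Analysis"
begin

end

theory Submission
  imports Defs
begin

text \<open>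
  Put \<open>a\<^sub>n = (2n choose n)\<^sup>2 / 16\<^sup>n\<close> and \<open>b\<^sub>j = 1 / ((2j + 1)\<^sup>2 a\<^sub>j)\<close>. These are
  \<open>central_sq\<close> and \<open>dual_sq\<close> below. For any sequence \<open>h\<close> let \<open>B\<^sub>m(h)\<close> (\<open>weighted_transform\<close>) be
  the sum of \<open>(-1)\<^sup>j (m choose j) b\<^sub>j h\<^sub>j\<close> over \<open>j \<le> m\<close>. Since the prefactor on the
  right of both identities is \<open>1 / b\<^sub>m\<close>, they say that \<open>b\<^sub>m\<close> times the sum of the \<open>a\<^sub>n\<close> is \<open>B\<^sub>m(1)\<close>,
  and that \<open>b\<^sub>m\<close> times the sum of the \<open>a\<^sub>n H\<^sub>n\<close> is \<open>H\<^sub>m B\<^sub>m(1) + B\<^sub>m(H)\<close>.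

  The ratio \<open>b\<^sub>j\<^sub>+\<^sub>1 / b\<^sub>j = (2j + 2)\<^sup>2 / (2j + 3)\<^sup>2\<close> is a rational function of \<open>j\<close>, and
  this turns summation by parts into a first-order recurrence in \<open>m\<close> valid for every \<open>h\<close>
  (lemma \<open>weighted_transform_recurrence\<close>):
  \[ (2m+3)^2 B_{m+1}(h) - (2m+2)^2 B_m(h) = h_0 - 4(m+1) B_m(j \mapsto (j+1)(h_{j+1}-h_j)). \]
  For \<open>h = 1\<close> the last term vanishes; for \<open>h = H\<close> its argument is the constant sequence \<open>1\<close>, so
  that the transform of the harmonic numbers is driven by \<open>B\<^sub>m(1)\<close> alone. The resulting term
  \<open>- 4(m + 1) B\<^sub>m(1)\<close> is exactly cancelled by the growth of the factor \<open>H\<^sub>m\<close> in \<open>H\<^sub>m B\<^sub>m(1)\<close>.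
  Hence \<open>y\<^sub>m = B\<^sub>m(1)\<close> and \<open>y\<^sub>m = H\<^sub>m B\<^sub>m(1) + B\<^sub>m(H)\<close> satisfy
  \<open>(2m + 3)\<^sup>2 y\<^sub>m\<^sub>+\<^sub>1 - (2m + 2)\<^sup>2 y\<^sub>m = f\<^sub>m\<^sub>+\<^sub>1\<close> with \<open>f = 1\<close> and
  \<open>f = H\<close> respectively. The recurrence of \<open>b\<close> shows that its solutions with \<open>y\<^sub>0 = f\<^sub>0\<close> are \<open>b\<^sub>m\<close> times
  the partial sums of the \<open>a\<^sub>n f\<^sub>n\<close> (lemma \<open>partial_sum_of_recurrence\<close>).
\<close>

definition central_sq :: "nat \<Rightarrow> real" where
  "central_sq n = real ((2 * n) choose n) ^ 2 / 16 ^ n"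

definition dual_sq :: "nat \<Rightarrow> real" where
  "dual_sq j = 1 / ((2 * real j + 1) ^ 2 * central_sq j)"

definition weighted_transform :: "(nat \<Rightarrow> real) \<Rightarrow> nat \<Rightarrow> real" where
  "weighted_transform h m = (\<Sum>j\<le>m. (-1) ^ j * real (m choose j) * (dual_sq j * h j))"

lemma central_sq_pos: "central_sq n > 0"
  by (simp add: central_sq_def)

lemma central_sq_0: "central_sq 0 = 1"
  by (simp add: central_sq_def)

lemma dual_sq_0: "dual_sq 0 = 1"
  by (simp add: dual_sq_def central_sq_0)

lemma central_binomial_Suc:
  "real (Suc n) * real ((2 * Suc n) choose Suc n) = 2 * (2 * real n + 1) * real ((2 * n) choose n)"
proof -
  have 1: "Suc n * (2 * Suc n choose Suc n) = 2 * Suc n * (Suc (2 * n) choose n)"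
    using Suc_times_binomial[of n "Suc (2 * n)"] by simp
  have 2: "Suc n * (Suc (2 * n) choose n) = (2 * n + 1) * (2 * n choose n)"
    using binomial_absorb_comp[of "Suc (2 * n)" n] by (simp add: Suc_diff_le)
  have "Suc n * (2 * Suc n choose Suc n) = 2 * (2 * n + 1) * (2 * n choose n)"
    using 1 2 by (metis mult.assoc)
  then have "real (Suc n * (2 * Suc n choose Suc n)) = real (2 * (2 * n + 1) * (2 * n choose n))"
    by (rule arg_cong)
  then show ?thesis
    by (simp only: of_nat_mult of_nat_add of_nat_numeral of_nat_1)
qed

lemma central_sq_Suc: "(2 * real n + 2) ^ 2 * central_sq (Suc n) = (2 * real n + 1) ^ 2 * central_sq n"
proof -
  have "(real (Suc n) * real ((2 * Suc n) choose Suc n)) ^ 2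
      = (2 * (2 * real n + 1) * real ((2 * n) choose n)) ^ 2"
    by (simp only: central_binomial_Suc)
  moreover have "2 * real n + 2 = 2 * real (Suc n)" by simp
  ultimately show ?thesis
    unfolding central_sq_def by (simp only: power_mult_distrib) (simp add: field_simps)
qed

lemma dual_sq_times_square: "(2 * real j + 1) ^ 2 * dual_sq j = 1 / central_sq j"
  by (simp add: dual_sq_def)

lemma dual_sq_Suc: "(2 * real j + 3) ^ 2 * dual_sq (Suc j) = (2 * real j + 2) ^ 2 * dual_sq j"
proof -
  have nz: "central_sq j \<noteq> 0" "central_sq (Suc j) \<noteq> 0" "2 * real j + 1 \<noteq> 0"
    using central_sq_pos[of j] central_sq_pos[of "Suc j"] by (auto simp: add_nonneg_eq_0_iff)
  have "(2 * real j + 3) ^ 2 * dual_sq (Suc j) = 1 / central_sq (Suc j)"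
    using dual_sq_times_square[of "Suc j"] by (simp add: algebra_simps)
  also have "\<dots> = (2 * real j + 2) ^ 2 / ((2 * real j + 1) ^ 2 * central_sq j)"
    using central_sq_Suc[of j] nz by (simp add: divide_simps mult.commute)
  finally show ?thesis
    by (simp add: dual_sq_def)
qed

text \<open>
  Applied to the binomial coefficients, the recurrence operator in \<open>m\<close> becomes a shift operator in
  \<open>j\<close> whose coefficients do not involve \<open>m\<close>. These coefficients are the ones that \<open>dual_sq_Suc\<close> relates,
  which is what makes the sum in the next lemma telescope.
\<close>

lemma binomial_recurrence_operator:
  "(2 * real m + 3) ^ 2 * real (Suc m choose j) - (2 * real m + 2) ^ 2 * real (m choose j)
    = (2 * real j + 1) ^ 2 * real (Suc m choose j)
      + (2 * real j + 2) ^ 2 * real (Suc m choose Suc j)"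
proof (cases "j \<le> Suc m")
  case True
  define c d e where "c = real (Suc m choose j)" and "d = real (m choose j)"
    and "e = real (Suc m choose Suc j)"
  have d: "(real m + 1) * d = (real m + 1 - real j) * c"
  proof -
    have "real ((Suc m - j) * (Suc m choose j)) = real (Suc m * (m choose j))"
      using binomial_absorb_comp[of "Suc m" j] by simp
    then have "(1 + real m - real j) * c = (1 + real m) * d"
      unfolding c_def d_def by (simp only: of_nat_mult of_nat_diff[OF True] of_nat_Suc)
    then show ?thesis
      by (simp only: add.commute)
  qed
  have e: "(real j + 1) * e = (real m + 1) * d"
  proof -
    have "real (Suc j * (Suc m choose Suc j)) = real (Suc m * (m choose j))"
      by (simp only: Suc_times_binomial)
    then show ?thesis
      unfolding d_def e_def by (simp only: of_nat_mult of_nat_Suc add.commute)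
  qed
  have "(2 * real m + 2) ^ 2 * d = 4 * (real m + 1) * ((real m + 1) * d)"
       "(2 * real j + 2) ^ 2 * e = 4 * (real j + 1) * ((real j + 1) * e)"
    by (simp_all add: power2_eq_square algebra_simps)
  then have "(2 * real m + 3) ^ 2 * c - (2 * real m + 2) ^ 2 * d
    = (2 * real j + 1) ^ 2 * c + (2 * real j + 2) ^ 2 * e"
    unfolding e d by (simp add: power2_eq_square algebra_simps)
  then show ?thesis
    by (simp only: c_def d_def e_def)
qed (simp add: binomial_eq_0)

text \<open>
  Summation by parts: with \<open>u\<^sub>j = (-1)\<^sup>j (m + 1 choose j) (2j + 1)\<^sup>2 b\<^sub>j h\<^sub>j\<close>, each summand of the
  left-hand side is \<open>u\<^sub>j - u\<^sub>j\<^sub>+\<^sub>1\<close> plus a remainder containing \<open>h\<^sub>j\<^sub>+\<^sub>1 - h\<^sub>j\<close>. The upper boundary term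
  vanishes because its binomial coefficient does.
\<close>

lemma weighted_transform_recurrence:
  "(2 * real m + 3) ^ 2 * weighted_transform h (Suc m)
      - (2 * real m + 2) ^ 2 * weighted_transform h m
    = h 0 - 4 * (real m + 1)
        * weighted_transform (\<lambda>j. (real j + 1) * (h (Suc j) - h j)) m"
proof -
  define u where
    "u j = (-1) ^ j * real (Suc m choose j) * ((2 * real j + 1) ^ 2 * dual_sq j) * h j" for j
  define v where
    "v j = (-1) ^ j * real (m choose j) * (dual_sq j * ((real j + 1) * (h (Suc j) - h j)))" for j
  have summand: "(2 * real m + 3) ^ 2 * ((-1) ^ j * real (Suc m choose j) * (dual_sq j * h j))
      - (2 * real m + 2) ^ 2 * ((-1) ^ j * real (m choose j) * (dual_sq j * h j))
    = (u j - u (Suc j)) - 4 * (real m + 1) * v j" (is "?l = _") for j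
  proof -
    have absorb: "(2 * real j + 2) ^ 2 * real (Suc m choose Suc j)
        = 4 * (real m + 1) * (real j + 1) * real (m choose j)"
    proof -
      have "real (Suc j * (Suc m choose Suc j)) = real (Suc m * (m choose j))"
        by (simp only: Suc_times_binomial)
      then have "(real j + 1) * real (Suc m choose Suc j) = (real m + 1) * real (m choose j)"
        by (simp only: of_nat_mult of_nat_Suc add.commute)
      moreover have "(2 * real j + 2) ^ 2 * real (Suc m choose Suc j)
          = 4 * (real j + 1) * ((real j + 1) * real (Suc m choose Suc j))"
        by (simp add: power2_eq_square algebra_simps)
      ultimately show ?thesis by (simp only:) (simp only: mult_ac)
    qed
    have "2 * real (Suc j) + 1 = 2 * real j + 3" by simp
    then have "u (Suc j) = (-1) ^ Suc j * real (Suc m choose Suc j)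
        * ((2 * real j + 3) ^ 2 * dual_sq (Suc j)) * h (Suc j)"
      unfolding u_def by (simp only:)
    also have "\<dots> = - ((-1) ^ j * dual_sq j * h (Suc j)
        * ((2 * real j + 2) ^ 2 * real (Suc m choose Suc j)))"
      unfolding dual_sq_Suc by simp
    finally have u_Suc: "u (Suc j) = - ((-1) ^ j * dual_sq j * h (Suc j)
        * ((2 * real j + 2) ^ 2 * real (Suc m choose Suc j)))" .
    have "4 * (real m + 1) * v j
        = (-1) ^ j * dual_sq j * (h (Suc j) - h j) * ((2 * real j + 2) ^ 2 * real (Suc m choose Suc j))"
      unfolding v_def absorb by (simp only: mult_ac)
    then have "(u j - u (Suc j)) - 4 * (real m + 1) * v j
        = (-1) ^ j * dual_sq j * h j * ((2 * real j + 1) ^ 2 * real (Suc m choose j)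
            + (2 * real j + 2) ^ 2 * real (Suc m choose Suc j))"
      unfolding u_Suc by (simp only: u_def) (simp only: algebra_simps)
    also have "\<dots> = (-1) ^ j * dual_sq j * h j * ((2 * real m + 3) ^ 2 * real (Suc m choose j)
        - (2 * real m + 2) ^ 2 * real (m choose j))"
      by (simp only: binomial_recurrence_operator)
    also have "\<dots> = ?l"
      by (simp only: right_diff_distrib mult_ac)
    finally show ?thesis ..
  qed
  \<comment> \<open>All sums are taken up to \<open>m + 1\<close>, which adds a vanishing summand to the transforms at \<open>m\<close>.\<close>
  have extend: "weighted_transform g m
      = (\<Sum>j\<le>Suc m. (-1) ^ j * real (m choose j) * (dual_sq j * g j))" for g
    by (simp add: weighted_transform_def binomial_eq_0)
  have "(2 * real m + 3) ^ 2 * weighted_transform h (Suc m)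
      - (2 * real m + 2) ^ 2 * weighted_transform h m
    = (\<Sum>j\<le>Suc m. (u j - u (Suc j)) - 4 * (real m + 1) * v j)"
    unfolding extend weighted_transform_def[of h "Suc m"] sum_distrib_left
      sum_subtractf[symmetric] summand ..
  also have "\<dots> = (\<Sum>j\<le>Suc m. u j - u (Suc j)) - 4 * (real m + 1) * (\<Sum>j\<le>Suc m. v j)"
    by (simp only: sum_subtractf sum_distrib_left)
  also have "(\<Sum>j\<le>Suc m. u j - u (Suc j)) = u 0 - u (Suc (Suc m))"
    by (rule sum_telescope)
  also have "\<dots> = h 0"
    by (simp add: u_def dual_sq_0 binomial_eq_0)
  finally show ?thesis
    by (simp only: extend v_def)
qed

text \<open>
  By \<open>dual_sq_Suc\<close>, \<open>b\<close> solves the homogeneous recurrence. Writing \<open>y\<^sub>m = b\<^sub>m s\<^sub>m\<close> therefore leaves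
  \<open>s\<^sub>m\<^sub>+\<^sub>1 - s\<^sub>m = a\<^sub>m\<^sub>+\<^sub>1 f\<^sub>m\<^sub>+\<^sub>1\<close>, because \<open>(2m + 3)\<^sup>2 b\<^sub>m\<^sub>+\<^sub>1\<close> is the inverse of \<open>a\<^sub>m\<^sub>+\<^sub>1\<close>.
\<close>

lemma partial_sum_of_recurrence:
  assumes "y 0 = f 0"
    and "\<And>m. (2 * real m + 3) ^ 2 * y (Suc m) - (2 * real m + 2) ^ 2 * y m = f (Suc m)"
  shows "y m = dual_sq m * (\<Sum>n\<le>m. central_sq n * f n)"
proof (induction m)
  case 0
  then show ?case by (simp add: assms(1) central_sq_0 dual_sq_0)
next
  case (Suc m)
  have nz: "2 * real m + 3 \<noteq> 0" by (simp add: add_nonneg_eq_0_iff)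
  have ba: "(2 * real m + 3) ^ 2 * dual_sq (Suc m) * central_sq (Suc m) = 1"
    using dual_sq_times_square[of "Suc m"] central_sq_pos[of "Suc m"] by (simp add: algebra_simps)
  have "(2 * real m + 3) ^ 2 * y (Suc m) = (2 * real m + 2) ^ 2 * dual_sq m * (\<Sum>n\<le>m. central_sq n * f n)
      + (2 * real m + 3) ^ 2 * dual_sq (Suc m) * central_sq (Suc m) * f (Suc m)"
    using assms(2)[of m] unfolding ba Suc.IH by (simp only: algebra_simps)
  also have "\<dots> = (2 * real m + 3) ^ 2 * (dual_sq (Suc m) * (\<Sum>n\<le>Suc m. central_sq n * f n))"
    unfolding dual_sq_Suc[symmetric] by (simp add: distrib_left)
  finally show ?case
    using nz by simp
qed

lemma weighted_transform_one: "weighted_transform (\<lambda>_. 1) m = dual_sq m * (\<Sum>n\<le>m. central_sq n)"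
proof -
  have "weighted_transform (\<lambda>_. 1) m = dual_sq m * (\<Sum>n\<le>m. central_sq n * (\<lambda>_. 1) n)"
    by (rule partial_sum_of_recurrence, unfold weighted_transform_recurrence)
      (simp_all add: weighted_transform_def dual_sq_0)
  then show ?thesis by simp
qed

lemma weighted_transform_harm:
  "harm m * weighted_transform (\<lambda>_. 1) m + weighted_transform harm m
    = dual_sq m * (\<Sum>n\<le>m. central_sq n * harm n)"
proof (rule partial_sum_of_recurrence)
  show "harm 0 * weighted_transform (\<lambda>_. 1) 0 + weighted_transform harm 0 = harm 0"
    by (simp add: weighted_transform_def dual_sq_0 harm_def)
next
  fix m
  define T where "T = weighted_transform (\<lambda>_. 1)"
  define U where "U = weighted_transform harm"
  have "(2 * real m + 3) ^ 2 * T (Suc m) - (2 * real m + 2) ^ 2 * T m = 1"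
    unfolding T_def weighted_transform_recurrence by (simp add: weighted_transform_def)
  then have T: "(2 * real m + 3) ^ 2 * T (Suc m) = 1 + (2 * real m + 2) ^ 2 * T m"
    by simp
  \<comment> \<open>The weighted differences of \<open>harm\<close> are constant, which brings in \<open>T\<close>.\<close>
  have "(real j + 1) * (harm (Suc j) - harm j) = (1::real)" for j
    by (simp add: harm_Suc field_simps)
  then have U: "(2 * real m + 3) ^ 2 * U (Suc m) = (2 * real m + 2) ^ 2 * U m - 4 * (real m + 1) * T m"
    using weighted_transform_recurrence[of m harm] by (simp add: U_def T_def harm_def)
  have H: "(2 * real m + 2) ^ 2 * harm (Suc m) = (2 * real m + 2) ^ 2 * harm m + 4 * (real m + 1)"
    by (simp add: harm_Suc field_simps power2_eq_square)
  have "(2 * real m + 3) ^ 2 * (harm (Suc m) * T (Suc m) + U (Suc m))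
      = harm (Suc m) * ((2 * real m + 3) ^ 2 * T (Suc m)) + (2 * real m + 3) ^ 2 * U (Suc m)"
    by (simp only: algebra_simps)
  also have "\<dots> = harm (Suc m) + ((2 * real m + 2) ^ 2 * harm (Suc m)) * T m
      + ((2 * real m + 2) ^ 2 * U m - 4 * (real m + 1) * T m)"
    unfolding T U by (simp only: algebra_simps)
  also have "\<dots> = harm (Suc m) + (2 * real m + 2) ^ 2 * (harm m * T m + U m)"
    unfolding H by (simp only: algebra_simps)
  finally show "(2 * real m + 3) ^ 2
        * (harm (Suc m) * weighted_transform (\<lambda>_. 1) (Suc m) + weighted_transform harm (Suc m))
      - (2 * real m + 2) ^ 2
        * (harm m * weighted_transform (\<lambda>_. 1) m + weighted_transform harm m)
      = harm (Suc m)"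
    by (simp add: T_def U_def)
qed

theorem corollary6p4:
  fixes m :: nat
  shows "(\<Sum>n=0..m. 1 / 16 ^ n * real ((2 * n) choose n) ^ 2)
      = (2 * real m + 1) ^ 2 / 16 ^ m * real ((2 * m) choose m) ^ 2
        * (\<Sum>j=0..m. (-1) ^ j * real (m choose j)
             * (16 ^ j / ((2 * real j + 1) ^ 2 * real ((2 * j) choose j) ^ 2)))
    \<and> (\<Sum>n=0..m. 1 / 16 ^ n * real ((2 * n) choose n) ^ 2 * harm n)
      = (2 * real m + 1) ^ 2 / 16 ^ m * real ((2 * m) choose m) ^ 2
        * (\<Sum>j=0..m. (-1) ^ j * real (m choose j)
             * (16 ^ j * (harm m + harm j) / ((2 * real j + 1) ^ 2 * real ((2 * j) choose j) ^ 2)))"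
proof -
  have a: "1 / 16 ^ n * real ((2 * n) choose n) ^ 2 = central_sq n" for n
    by (simp add: central_sq_def)
  have b: "16 ^ j / ((2 * real j + 1) ^ 2 * real ((2 * j) choose j) ^ 2) = dual_sq j" for j
    by (simp add: dual_sq_def central_sq_def)
  have bh: "16 ^ j * h / ((2 * real j + 1) ^ 2 * real ((2 * j) choose j) ^ 2) = dual_sq j * h" for j h
    unfolding b[symmetric] by simp
  have prefactor: "(2 * real m + 1) ^ 2 / 16 ^ m * real ((2 * m) choose m) ^ 2 = 1 / dual_sq m"
    by (simp add: dual_sq_def central_sq_def)
  have "dual_sq m \<noteq> 0"
    using central_sq_pos[of m] by (simp add: dual_sq_def add_nonneg_eq_0_iff)
  then have "(\<Sum>n\<le>m. central_sq n) = 1 / dual_sq m * weighted_transform (\<lambda>_. 1) m"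
    "(\<Sum>n\<le>m. central_sq n * harm n)
      = 1 / dual_sq m * (harm m * weighted_transform (\<lambda>_. 1) m + weighted_transform harm m)"
    unfolding weighted_transform_harm unfolding weighted_transform_one by simp_all
  moreover have "harm m * weighted_transform (\<lambda>_. 1) m + weighted_transform harm m
      = (\<Sum>j\<le>m. (-1) ^ j * real (m choose j) * (dual_sq j * (harm m + harm j)))"
    by (simp add: weighted_transform_def sum_distrib_left sum.distrib[symmetric] algebra_simps)
  ultimately show ?thesis
    unfolding a b bh prefactor atLeast0AtMost by (simp add: weighted_transform_def)
qed

end
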